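(* Let $M$ be a generator of an irreducible Markov chain on a finite state space $\mathcal Z$. The generalised log-Sobolev constant $\zeta\mapsto\alpha_{\mathrm{gLSI}}(\zeta)$ is continuous on $\mathcal P_+(\mathcal Z)$.
   Context: $\mathcal Z$ is a finite set with $|\mathcal Z|\ge2$. A generator is a matrix $M\in\mathbb R^{|\mathcal Z|\times|\mathcal Z|}$ with off-diagonal entries $\ge0$ and rows summing to $0$; reversibility is not assumed. $\mathcal P_+(\mathcal Z)$ is the set of strictly positive probability measures on $\mathcal Z$, viewed as a subset of $\mathbb R^{|\mathcal Z|}$. $\mathbf 1$ is the constant function $1$. For $\zeta\in\mathcal P_+(\mathcal Z)$: $\mathcal D_\zeta(\mathcal Z)=\{\varphi\in\mathbb R^{|\mathcal Z|}:\varphi(z)>0\ \forall z,\ \sum_z\varphi(z)\zeta(z)=1\}$; relative entropy $\mathscr H_\zeta(\varphi)=\sum_z\varphi(z)\log\varphi(z)\,\zeta(z)$; generalised Fisher information $$\mathscr R_\zeta(\varphi)=\sum_{z,z'\in\mathcal Z}M(z,z')\zeta(z)\varphi(z)\Bigl[\tfrac{\varphi(z')}{\varphi(z)}-1-\log\tfrac{\varphi(z')}{\varphi(z)}\Bigr];$$ and the generalised log-Sobolev constant $$\alpha_{\mathrm{gLSI}}(\zeta)=\inf_{\varphi\in\mathcal D_\zeta(\mathcal Z),\,\varphi\ne\mathbf 1}\frac{\mathscr R_\zeta(\varphi)}{\mathscr H_\zeta(\varphi)}.$$ *)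

theory Defs
  imports "HOL-Analysis.Analysis"
begin

text \<open>The finite state space is the universe of a finite type \<open>'z\<close>; measures and functions on it
  are vectors in \<open>real ^ 'z\<close>, and \<open>M $ z $ z'\<close> is the entry $M(z,z')$.\<close>

definition generator :: "real ^ 'z ^ 'z \<Rightarrow> bool" where
  "generator M \<longleftrightarrow>
     (\<forall>z z'. z \<noteq> z' \<longrightarrow> M $ z $ z' \<ge> 0) \<and> (\<forall>z. (\<Sum>z'\<in>UNIV. M $ z $ z') = 0)"

text \<open>Every state is reachable from every other one through jumps of positive rate.\<close>

definition irreducible_generator :: "real ^ 'z ^ 'z \<Rightarrow> bool" where
  "irreducible_generator M \<longleftrightarrow>
     generator M \<and> (\<forall>z z'. (z, z') \<in> {(x, y). x \<noteq> y \<and> M $ x $ y > 0}\<^sup>*)"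

definition pos_prob :: "(real ^ 'z) set" where
  "pos_prob = {\<zeta>. (\<forall>z. \<zeta> $ z > 0) \<and> (\<Sum>z\<in>UNIV. \<zeta> $ z) = 1}"

definition pos_densities :: "real ^ 'z \<Rightarrow> (real ^ 'z) set" where
  "pos_densities \<zeta> = {\<phi>. (\<forall>z. \<phi> $ z > 0) \<and> (\<Sum>z\<in>UNIV. \<phi> $ z * \<zeta> $ z) = 1}"

definition rel_entropy :: "real ^ 'z \<Rightarrow> real ^ 'z \<Rightarrow> real" where
  "rel_entropy \<zeta> \<phi> = (\<Sum>z\<in>UNIV. \<phi> $ z * ln (\<phi> $ z) * \<zeta> $ z)"

definition fisher_info :: "real ^ 'z ^ 'z \<Rightarrow> real ^ 'z \<Rightarrow> real ^ 'z \<Rightarrow> real" where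
  "fisher_info M \<zeta> \<phi> =
     (\<Sum>z\<in>UNIV. \<Sum>z'\<in>UNIV.
        M $ z $ z' * \<zeta> $ z * \<phi> $ z * (\<phi> $ z' / \<phi> $ z - 1 - ln (\<phi> $ z' / \<phi> $ z)))"

text \<open>The infimum is taken in the reals. For a generator \<open>M\<close>, a strictly positive \<open>\<zeta>\<close> and at least
  two states it is a genuine infimum: the index set is nonempty, the entropy is positive off the
  constant \<open>1\<close>, and the quotients are bounded below by \<open>0\<close>. The vector \<open>1 :: real ^ 'z\<close> is
  the constant function \<open>1\<close>.\<close>

definition alpha_gLSI :: "real ^ 'z ^ 'z \<Rightarrow> real ^ 'z \<Rightarrow> real" where
  "alpha_gLSI M \<zeta> =
     (INF \<phi> \<in> pos_densities \<zeta> - {1}. fisher_info M \<zeta> \<phi> / rel_entropy \<zeta> \<phi>)"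

end

(* Both functionals are integrals of nonnegative integrands against the reference measure: this is
   clear for the Fisher information, while the entropy of phi, normalised to mass one, is the
   minimum over t > 0 of the integral of phi ln phi - phi ln t - phi + t. Hence, as in the
   Holley-Stroock perturbation argument, measures whose pointwise ratios are at most c have
   constants differing by a factor of at most c^2. Continuity follows, as c tends to 1 when one
   measure tends to the other. *)
theory Submission
  imports Defs
begin

text \<open>The expression is the Bregman divergence of x ln x at 1, and the bound is ln y < y - 1
  at y = 1/x, multiplied by x. Strictness is what later makes the entropy positive.\<close>

lemma xlnx_bregman_pos:
  fixes x :: real
  assumes "x > 0" "x \<noteq> 1"
  shows "x * ln x - x + 1 > 0"
proof -
  have "ln (1 / x) < 1 / x - 1"
    using assms ln_le_minus_one[of "1 / x"] ln_eq_minus_one[of "1 / x"] by fastforce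
  then have "x * ln (1 / x) < x * (1 / x - 1)"
    using assms by simp
  then show ?thesis
    using assms by (simp add: ln_div algebra_simps)
qed

lemma xlnx_bregman_nonneg:
  fixes x :: real
  assumes "x > 0"
  shows "x * ln x - x + 1 \<ge> 0"
  using xlnx_bregman_pos[OF assms] by (cases "x = 1") auto

text \<open>Under \<zeta> both \<phi> and 1 have integral one, so the added terms cancel; they make
  every summand nonnegative.\<close>

lemma rel_entropy_eq:
  assumes "\<zeta> \<in> pos_prob" "\<phi> \<in> pos_densities \<zeta>"
  shows "rel_entropy \<zeta> \<phi> = (\<Sum>z\<in>UNIV. (\<phi> $ z * ln (\<phi> $ z) - \<phi> $ z + 1) * \<zeta> $ z)"
  using assms
  by (simp add: rel_entropy_def pos_prob_def pos_densities_def distrib_right left_diff_distrib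
      sum.distrib sum_subtractf)

lemma rel_entropy_pos:
  assumes "\<zeta> \<in> pos_prob" "\<phi> \<in> pos_densities \<zeta>" "\<phi> \<noteq> 1"
  shows "rel_entropy \<zeta> \<phi> > 0"
proof -
  obtain w where "\<phi> $ w \<noteq> 1"
    using \<open>\<phi> \<noteq> 1\<close> by (metis one_index vec_eq_iff)
  moreover have "\<zeta> $ z > 0" "\<phi> $ z > 0" for z
    using assms(1,2) by (simp_all add: pos_prob_def pos_densities_def)
  ultimately show ?thesis
    unfolding rel_entropy_eq[OF assms(1,2)]
    by (intro sum_pos2[of _ w])
      (simp_all add: xlnx_bregman_pos xlnx_bregman_nonneg less_imp_le)
qed

text \<open>The diagonal rates may be negative, but there the bracket vanishes. Off the diagonal the
  rate is nonnegative and so is the bracket, by ln r \<le> r - 1.\<close>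

lemma fisher_info_integrand_nonneg:
  assumes "generator M" "\<And>z. \<phi> $ z > 0"
  shows "M $ z $ z' * \<phi> $ z * (\<phi> $ z' / \<phi> $ z - 1 - ln (\<phi> $ z' / \<phi> $ z)) \<ge> 0"
proof (cases "z = z'")
  case True
  then show ?thesis using assms(2)[of z] by simp
next
  case False
  have "\<phi> $ z' / \<phi> $ z > 0"
    using assms(2) by simp
  then have "\<phi> $ z' / \<phi> $ z - 1 - ln (\<phi> $ z' / \<phi> $ z) \<ge> 0"
    using ln_le_minus_one by fastforce
  then show ?thesis
    using assms False by (intro mult_nonneg_nonneg) (auto simp: generator_def less_imp_le)
qed

lemma fisher_info_eq:
  "fisher_info M \<zeta> \<phi> = (\<Sum>z\<in>UNIV. \<Sum>z'\<in>UNIV.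
     \<zeta> $ z * (M $ z $ z' * \<phi> $ z * (\<phi> $ z' / \<phi> $ z - 1 - ln (\<phi> $ z' / \<phi> $ z))))"
  unfolding fisher_info_def by (simp add: mult_ac)

lemma fisher_info_nonneg:
  assumes "generator M" "\<And>z. \<phi> $ z > 0" "\<And>z. \<zeta> $ z \<ge> 0"
  shows "fisher_info M \<zeta> \<phi> \<ge> 0"
  unfolding fisher_info_eq
  by (intro sum_nonneg mult_nonneg_nonneg fisher_info_integrand_nonneg assms)

text \<open>The functional is linear in the measure, with the nonnegative coefficients of
  \<open>fisher_info_integrand_nonneg\<close>. Only positivity of \<phi> matters, so \<phi> need not
  be normalised for either measure.\<close>

lemma fisher_info_mono:
  assumes "generator M" "\<And>z. \<phi> $ z > 0" "\<And>z. \<zeta>' $ z \<le> c * \<zeta> $ z"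
  shows "fisher_info M \<zeta>' \<phi> \<le> c * fisher_info M \<zeta> \<phi>"
  unfolding fisher_info_eq sum_distrib_left mult.assoc[symmetric, of c]
  by (intro sum_mono mult_right_mono fisher_info_integrand_nonneg assms)

text \<open>The bracket sees only ratios of \<phi>, so just the prefactor scales. This undoes the
  normalisation when the measure changes.\<close>

lemma fisher_info_scaleR:
  assumes "k > 0"
  shows "fisher_info M \<zeta> (k *\<^sub>R \<phi>) = k * fisher_info M \<zeta> \<phi>"
  unfolding fisher_info_def sum_distrib_left using assms by (simp add: mult_ac)

lemma rel_entropy_compare:
  assumes "\<zeta> \<in> pos_prob" "\<zeta>' \<in> pos_prob" "\<phi> \<in> pos_densities \<zeta>"
    and "\<And>z. \<zeta> $ z \<le> c * \<zeta>' $ z" and m: "m > 0" "(1 / m) *\<^sub>R \<phi> \<in> pos_densities \<zeta>'"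
  shows "rel_entropy \<zeta> \<phi> \<le> c * m * rel_entropy \<zeta>' ((1 / m) *\<^sub>R \<phi>)"
proof -
  let ?b = "\<lambda>x. x * ln x - x + (1::real)"
  have pos: "\<phi> $ z > 0" for z
    using assms(3) by (simp add: pos_densities_def)
  \<comment> \<open>The right-hand side is the integrand of the variational formula at t = m, the
    \<zeta>'-mass of \<phi>.\<close>
  have scale: "m * ?b (x / m) = x * ln x - x * ln m - x + m" if "x > 0" for x
    using m that by (simp add: ln_div field_simps)
  have "(\<Sum>z\<in>UNIV. m * ?b (\<phi> $ z / m) * \<zeta> $ z)
      = (\<Sum>z\<in>UNIV. \<phi> $ z * ln (\<phi> $ z) * \<zeta> $ z - (ln m + 1) * (\<phi> $ z * \<zeta> $ z) + m * \<zeta> $ z)"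
    by (intro sum.cong refl) (simp only: scale pos, simp add: algebra_simps)
  \<comment> \<open>The excess m - 1 - ln m is the price of taking t = m in place of the minimiser t
    = 1; it is nonnegative.\<close>
  also have "\<dots> = rel_entropy \<zeta> \<phi> + (m - 1 - ln m)"
    using assms(1,3)
    by (simp add: sum.distrib sum_subtractf sum_distrib_left[symmetric] rel_entropy_def
        pos_prob_def pos_densities_def)
  finally have "rel_entropy \<zeta> \<phi> \<le> (\<Sum>z\<in>UNIV. m * ?b (\<phi> $ z / m) * \<zeta> $ z)"
    using ln_le_minus_one[OF m(1)] by simp
  \<comment> \<open>Now the integrand is pointwise nonnegative, unlike \<phi> ln \<phi>, so the
    measures can be compared state by state.\<close>
  also have "\<dots> \<le> (\<Sum>z\<in>UNIV. m * ?b (\<phi> $ z / m) * (c * \<zeta>' $ z))"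
    using m pos assms(4)
    by (intro sum_mono mult_left_mono mult_nonneg_nonneg xlnx_bregman_nonneg) auto
  also have "\<dots> = c * m * rel_entropy \<zeta>' ((1 / m) *\<^sub>R \<phi>)"
    unfolding rel_entropy_eq[OF assms(2) m(2)] sum_distrib_left by (simp add: mult_ac)
  finally show ?thesis .
qed

lemma pos_densities_normalize:
  fixes \<phi> \<zeta>' :: "real ^ 'z"
  assumes "\<And>z. \<phi> $ z > 0" "\<zeta>' \<in> pos_prob"
  obtains m where "m > 0" "(1 / m) *\<^sub>R \<phi> \<in> pos_densities \<zeta>'"
proof
  let ?m = "\<Sum>z\<in>UNIV. \<phi> $ z * \<zeta>' $ z"
  show "?m > 0"
    using assms by (intro sum_pos mult_pos_pos) (auto simp: pos_prob_def)
  then show "(1 / ?m) *\<^sub>R \<phi> \<in> pos_densities \<zeta>'"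
    using assms by (simp add: pos_densities_def sum_divide_distrib[symmetric])
qed

lemma pos_densities_const:
  fixes \<zeta> :: "real ^ 'z"
  assumes "\<zeta> \<in> pos_prob" "k *\<^sub>R 1 \<in> pos_densities \<zeta>"
  shows "k = 1"
  using assms by (simp add: pos_prob_def pos_densities_def sum_distrib_left[symmetric])

text \<open>Two states allow a positive function with two distinct values, which remain distinct
  after normalisation. This gives the infimum a nonempty index set.\<close>

lemma pos_densities_nontrivial:
  fixes \<zeta> :: "real ^ 'z"
  assumes "CARD('z) \<ge> 2" "\<zeta> \<in> pos_prob"
  shows "pos_densities \<zeta> - {1} \<noteq> {}"
proof -
  have "\<not> CARD('z) \<le> 1"
    using assms(1) by simp
  then obtain a b :: 'z where ab: "a \<noteq> b"
    unfolding card_le_Suc0_iff_eq[OF finite_class.finite_UNIV, folded One_nat_def] by auto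
  define \<phi> :: "real ^ 'z" where "\<phi> = (\<chi> z. if z = a then 2 else 1)"
  obtain m where m: "m > 0" "(1 / m) *\<^sub>R \<phi> \<in> pos_densities \<zeta>"
    by (rule pos_densities_normalize[of \<phi> \<zeta>]) (use assms(2) in \<open>auto simp: \<phi>_def\<close>)
  have "((1 / m) *\<^sub>R \<phi>) $ a \<noteq> ((1 / m) *\<^sub>R \<phi>) $ b"
    using ab m(1) by (simp add: \<phi>_def)
  then have "(1 / m) *\<^sub>R \<phi> \<noteq> 1"
    by (metis one_index)
  then show ?thesis
    using m(2) by blast
qed

lemma gLSI_quotient_nonneg:
  assumes "generator M" "\<zeta> \<in> pos_prob" "\<phi> \<in> pos_densities \<zeta> - {1}"
  shows "fisher_info M \<zeta> \<phi> / rel_entropy \<zeta> \<phi> \<ge> 0"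
  using assms rel_entropy_pos[of \<zeta> \<phi>]
  by (intro divide_nonneg_nonneg fisher_info_nonneg)
    (auto simp: pos_prob_def pos_densities_def less_imp_le)

text \<open>Each \<phi> competing for \<zeta> is renormalised to a competitor for \<zeta>'. One
  factor c comes from the Fisher information, the other from the entropy.\<close>

lemma alpha_gLSI_compare:
  fixes M :: "real ^ 'z ^ 'z"
  assumes card: "CARD('z) \<ge> 2" and M: "generator M"
    and \<zeta>: "\<zeta> \<in> pos_prob" and \<zeta>': "\<zeta>' \<in> pos_prob" and "c > 0"
    and le: "\<And>z. \<zeta> $ z \<le> c * \<zeta>' $ z" and ge: "\<And>z. \<zeta>' $ z \<le> c * \<zeta> $ z"
  shows "alpha_gLSI M \<zeta>' \<le> c\<^sup>2 * alpha_gLSI M \<zeta>"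
proof -
  have "alpha_gLSI M \<zeta>' / c\<^sup>2 \<le> alpha_gLSI M \<zeta>"
    unfolding alpha_gLSI_def[of M \<zeta>]
  proof (rule cINF_greatest[OF pos_densities_nontrivial[OF card \<zeta>]])
    fix \<phi> assume \<phi>: "\<phi> \<in> pos_densities \<zeta> - {1}"
    then have pos: "\<phi> $ z > 0" for z
      by (simp add: pos_densities_def)
    obtain m where m: "m > 0" "(1 / m) *\<^sub>R \<phi> \<in> pos_densities \<zeta>'"
      using pos_densities_normalize[OF pos \<zeta>'] by metis
    let ?\<psi> = "(1 / m) *\<^sub>R \<phi>"
    \<comment> \<open>Otherwise \<phi> would be the constant m, and the only constant density is
      1.\<close>
    have "?\<psi> \<noteq> 1"
    proof
      assume "?\<psi> = 1"
      then have "\<phi> = m *\<^sub>R 1"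
        using m(1) by (metis divide_self_if less_irrefl mult.commute mult_1 pth_1 scaleR_scaleR
            times_divide_eq_left)
      then show False
        using pos_densities_const[OF \<zeta>, of m] \<phi> by simp
    qed
    with m(2) have \<psi>: "?\<psi> \<in> pos_densities \<zeta>' - {1}"
      by blast
    have "alpha_gLSI M \<zeta>' \<le> fisher_info M \<zeta>' ?\<psi> / rel_entropy \<zeta>' ?\<psi>"
      unfolding alpha_gLSI_def using \<psi> gLSI_quotient_nonneg[OF M \<zeta>']
      by (intro cINF_lower bdd_belowI2) auto
    \<comment> \<open>The factor 1/m leaves the numerator and becomes the m that
      \<open>rel_entropy_compare\<close> puts beside the entropy.\<close>
    also have "\<dots> = fisher_info M \<zeta>' \<phi> / (m * rel_entropy \<zeta>' ?\<psi>)"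
      using m(1) by (simp add: fisher_info_scaleR)
    also have "\<dots> \<le> (c * fisher_info M \<zeta> \<phi>) / (rel_entropy \<zeta> \<phi> / c)"
    proof (rule frac_le)
      show "0 \<le> c * fisher_info M \<zeta> \<phi>"
        using \<open>c > 0\<close> \<zeta> pos M
        by (intro mult_nonneg_nonneg fisher_info_nonneg) (auto simp: pos_prob_def less_imp_le)
      show "fisher_info M \<zeta>' \<phi> \<le> c * fisher_info M \<zeta> \<phi>"
        by (rule fisher_info_mono[OF M pos ge])
      show "0 < rel_entropy \<zeta> \<phi> / c"
        using rel_entropy_pos[OF \<zeta>] \<phi> \<open>c > 0\<close> by simp
      show "rel_entropy \<zeta> \<phi> / c \<le> m * rel_entropy \<zeta>' ?\<psi>"
        using rel_entropy_compare[OF \<zeta> \<zeta>' _ le m] \<phi> \<open>c > 0\<close>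
        by (simp add: divide_le_eq mult_ac)
    qed
    finally show "alpha_gLSI M \<zeta>' / c\<^sup>2 \<le> fisher_info M \<zeta> \<phi> / rel_entropy \<zeta> \<phi>"
      using \<open>c > 0\<close> by (simp add: divide_le_eq power2_eq_square mult_ac)
  qed
  then show ?thesis
    using \<open>c > 0\<close> by (simp add: divide_le_eq mult.commute)
qed

theorem theorem4p4:
  fixes M :: "real ^ 'z ^ 'z"
  assumes "CARD('z) \<ge> 2"
    and "irreducible_generator M"
  shows "continuous_on (pos_prob :: (real ^ 'z) set) (alpha_gLSI M)"
  unfolding continuous_on_def
proof
  fix \<zeta> :: "real ^ 'z" assume \<zeta>: "\<zeta> \<in> pos_prob"
  have M: "generator M"
    using assms(2) by (simp add: irreducible_generator_def)
  let ?F = "at \<zeta> within pos_prob"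
  \<comment> \<open>Each ratio of the two measures at z is at most 1 plus their difference at z over
    the denominator. Sums in place of a maximum dominate all these ratios, in both directions, and
    pass to the limit termwise.\<close>
  define c where "c \<xi> = 1 + (\<Sum>z\<in>UNIV. \<bar>\<xi> $ z - \<zeta> $ z\<bar> / \<zeta> $ z)
    + (\<Sum>z\<in>UNIV. \<bar>\<xi> $ z - \<zeta> $ z\<bar> / \<xi> $ z)" for \<xi>
  have pos: "\<xi> $ z > 0" if "\<xi> \<in> pos_prob" for \<xi> :: "real ^ 'z" and z
    using that by (simp add: pos_prob_def)
  have bounds: "c \<xi> > 0 \<and> (\<forall>z. \<zeta> $ z \<le> c \<xi> * \<xi> $ z \<and> \<xi> $ z \<le> c \<xi> * \<zeta> $ z)"
    if \<xi>: "\<xi> \<in> pos_prob" for \<xi>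
  proof -
    let ?d = "\<lambda>z. \<bar>\<xi> $ z - \<zeta> $ z\<bar>"
    have nonneg: "?d z / \<zeta> $ z \<ge> 0" "?d z / \<xi> $ z \<ge> 0" for z
      using pos[OF \<zeta>, of z] pos[OF \<xi>, of z] by auto
    have sums: "(\<Sum>z\<in>UNIV. ?d z / \<zeta> $ z) \<ge> 0" "(\<Sum>z\<in>UNIV. ?d z / \<xi> $ z) \<ge> 0"
      using nonneg by (auto intro: sum_nonneg)
    have "\<zeta> $ z \<le> c \<xi> * \<xi> $ z \<and> \<xi> $ z \<le> c \<xi> * \<zeta> $ z" for z
    proof
      have "?d z / \<zeta> $ z \<le> (\<Sum>z\<in>UNIV. ?d z / \<zeta> $ z)" "?d z / \<xi> $ z \<le> (\<Sum>z\<in>UNIV. ?d z / \<xi> $ z)"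
        by (rule member_le_sum; use nonneg in simp)+
      then have le: "1 + ?d z / \<xi> $ z \<le> c \<xi>" "1 + ?d z / \<zeta> $ z \<le> c \<xi>"
        using sums by (simp_all add: c_def)
      have "\<zeta> $ z \<le> (1 + ?d z / \<xi> $ z) * \<xi> $ z"
        using pos[OF \<xi>, of z] by (simp add: distrib_right)
      also have "\<dots> \<le> c \<xi> * \<xi> $ z"
        using le(1) pos[OF \<xi>, of z] by (intro mult_right_mono) auto
      finally show "\<zeta> $ z \<le> c \<xi> * \<xi> $ z" .
      have "\<xi> $ z \<le> (1 + ?d z / \<zeta> $ z) * \<zeta> $ z"
        using pos[OF \<zeta>, of z] by (simp add: distrib_right)
      also have "\<dots> \<le> c \<xi> * \<zeta> $ z"
        using le(2) pos[OF \<zeta>, of z] by (intro mult_right_mono) auto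
      finally show "\<xi> $ z \<le> c \<xi> * \<zeta> $ z" .
    qed
    then show ?thesis
      using sums by (simp add: c_def)
  qed
  have "(c \<longlongrightarrow> 1 + (\<Sum>z\<in>UNIV. \<bar>\<zeta> $ z - \<zeta> $ z\<bar> / \<zeta> $ z)
    + (\<Sum>z\<in>UNIV. \<bar>\<zeta> $ z - \<zeta> $ z\<bar> / \<zeta> $ z)) ?F"
    unfolding c_def using pos[OF \<zeta>] by (intro tendsto_intros) (auto simp: less_imp_neq[symmetric])
  then have c: "(c \<longlongrightarrow> 1) ?F"
    by simp
  have ev: "\<forall>\<^sub>F \<xi> in ?F. \<xi> \<in> pos_prob"
    by (simp add: eventually_at_filter)
  show "(alpha_gLSI M \<longlongrightarrow> alpha_gLSI M \<zeta>) ?F"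
  \<comment> \<open>The comparison is used twice with \<zeta> and \<xi> exchanged; as
    \<open>c\<close> tends to 1, both bounds tend to the value at \<zeta>.\<close>
  proof (rule tendsto_sandwich)
    show "\<forall>\<^sub>F \<xi> in ?F. alpha_gLSI M \<zeta> / (c \<xi>)\<^sup>2 \<le> alpha_gLSI M \<xi>"
      using ev
    proof eventually_elim
      case (elim \<xi>)
      then show ?case
        using alpha_gLSI_compare[OF assms(1) M elim \<zeta>, of "c \<xi>"] bounds[OF elim]
        by (simp add: divide_le_eq mult.commute)
    qed
    show "\<forall>\<^sub>F \<xi> in ?F. alpha_gLSI M \<xi> \<le> (c \<xi>)\<^sup>2 * alpha_gLSI M \<zeta>"
      using ev
    proof eventually_elim
      case (elim \<xi>)
      then show ?case
        using alpha_gLSI_compare[OF assms(1) M \<zeta> elim, of "c \<xi>"] bounds[OF elim] by simp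
    qed
    have "((\<lambda>\<xi>. alpha_gLSI M \<zeta> / (c \<xi>)\<^sup>2) \<longlongrightarrow> alpha_gLSI M \<zeta> / 1\<^sup>2) ?F"
      by (intro tendsto_intros c) simp
    then show "((\<lambda>\<xi>. alpha_gLSI M \<zeta> / (c \<xi>)\<^sup>2) \<longlongrightarrow> alpha_gLSI M \<zeta>) ?F"
      by simp
    have "((\<lambda>\<xi>. (c \<xi>)\<^sup>2 * alpha_gLSI M \<zeta>) \<longlongrightarrow> 1\<^sup>2 * alpha_gLSI M \<zeta>) ?F"
      by (intro tendsto_intros c)
    then show "((\<lambda>\<xi>. (c \<xi>)\<^sup>2 * alpha_gLSI M \<zeta>) \<longlongrightarrow> alpha_gLSI M \<zeta>) ?F"
      by simp
  qed
qed

end
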